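(* Let $n \geq 4$. There is no constant $C<\infty$ such that $$\big\| e^{it|D|} u \big\|_{L^2_t L^\infty_x(\mathbb{R}\times\mathbb{R}^n)} \leq C \, \|u\|_{\dot H^{\frac{n-1}{2}}(\mathbb{R}^n)}$$ holds for all Schwartz functions $u \in \mathcal{S}(\mathbb{R}^n)$.
   Context: For $u\in\mathcal S(\mathbb R^n)$, $e^{it|D|}u$ is defined via the Fourier transform by $\widehat{e^{it|D|}u}(\xi) = e^{it|\xi|}\hat u(\xi)$; it solves the wave equation $(-\partial_t^2+\Delta)v=0$. The homogeneous Sobolev norm is $\|u\|_{\dot H^s} = \||\xi|^s \hat u(\xi)\|_{L^2_\xi}$ (up to the normalization of the Fourier transform). The space-time norm is $\|F\|_{L^2_tL^\infty_x}^2 = \int_{-\infty}^{\infty} \|F(t,\cdot)\|_{L^\infty(\mathbb R^n)}^2\,dt$. *)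

theory Defs
  imports "HOL-Analysis.Analysis"
begin

definition partial_dir :: "'n::finite \<Rightarrow> (real^'n \<Rightarrow> complex) \<Rightarrow> (real^'n \<Rightarrow> complex)" where
  "partial_dir i f = (\<lambda>x. vector_derivative (\<lambda>h. f (x + h *\<^sub>R axis i 1)) (at 0))"

text \<open>Iterated partial derivative; a list of directions encodes a multi-index.\<close>
fun partials :: "'n::finite list \<Rightarrow> (real^'n \<Rightarrow> complex) \<Rightarrow> (real^'n \<Rightarrow> complex)" where
  "partials [] f = f"
| "partials (i # is) f = partial_dir i (partials is f)"

text \<open>Schwartz space: all partial derivatives of all orders exist and are continuous
  (hence the function is C-infinity), and each one, multiplied by any power of (1 + |x|),
  is bounded.\<close>
definition schwartz :: "(real^'n::finite \<Rightarrow> complex) \<Rightarrow> bool" where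
  "schwartz f \<longleftrightarrow>
     (\<forall>ds. continuous_on UNIV (partials ds f)) \<and>
     (\<forall>ds i x. (\<lambda>h. partials ds f (x + h *\<^sub>R axis i 1)) differentiable (at 0)) \<and>
     (\<forall>ds (N::nat). bounded ((\<lambda>x. (1 + norm x) ^ N *\<^sub>R partials ds f x) ` UNIV))"

definition fourier :: "(real^'n::finite \<Rightarrow> complex) \<Rightarrow> real^'n \<Rightarrow> complex" where
  "fourier u \<xi> = (\<integral>x. u x * cis (- (x \<bullet> \<xi>)) \<partial>lborel)"

text \<open>The half-wave propagator (e^{it|D|} u)(x), via Fourier inversion.\<close>
definition half_wave :: "(real^'n::finite \<Rightarrow> complex) \<Rightarrow> real \<Rightarrow> real^'n \<Rightarrow> complex" where
  "half_wave u t x = complex_of_real (inverse ((2 * pi) ^ CARD('n))) *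
     (\<integral>\<xi>. cis (x \<bullet> \<xi> + t * norm \<xi>) * fourier u \<xi> \<partial>lborel)"

definition L2Linf_sq :: "(real \<Rightarrow> real^'n::finite \<Rightarrow> complex) \<Rightarrow> ennreal" where
  "L2Linf_sq F = (\<integral>\<^sup>+ t. (SUP x. ennreal (norm (F t x))) ^ 2 \<partial>lborel)"

text \<open>Square of the homogeneous Sobolev norm of order s = (n-1)/2, i.e.
  integral of |xi|^{n-1} |hat u(xi)|^2.\<close>
definition Hdot_sq :: "(real^'n::finite \<Rightarrow> complex) \<Rightarrow> real" where
  "Hdot_sq u = (\<integral>\<xi>. norm \<xi> ^ (CARD('n) - 1) * (norm (fourier u \<xi>))^2 \<partial>lborel)"

end

theory Submission
  imports Defs "HOL-Probability.Characteristic_Functions"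
begin

text \<open>
  The estimate already fails on the superluminal line \<open>x = \<surd>2 t e\<close>, where \<open>e\<close> is a coordinate unit
  vector. On that line the phase is \<open>t (|\<xi>| + \<surd>2 e \<bullet> \<xi>)\<close>, which is \<open>O(t)\<close> on the unit neighbourhood
  of the cone \<open>|\<xi>| + \<surd>2 e \<bullet> \<xi> = 0\<close>; this neighbourhood has volume of order \<open>2\<^bsup>k(n-1)\<^esup>\<close> in each
  dyadic shell \<open>|\<xi>| \<sim> 2\<^sup>k\<close>. Give \<open>u\<close> the Fourier transform \<open>|\<xi>|\<^bsup>-(n-1)\<^esup>\<close> there: with
  \<open>L\<close> the number of shells used, \<open>|e\<^bsup>it|D|\<^esup>u|\<close> is at least a constant times \<open>L\<close> on the line for all
  small \<open>t\<close>, whereas the square of the Sobolev norm is only of order \<open>L\<close>.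

  To have explicit Schwartz functions, \<open>u\<close> is a finite sum of modulated Gaussians, centred in frequency at
  the points \<open>\<eta> = (-|k|, k)\<close> of the cone, \<open>k\<close> running through \<open>{1..R}\<^bsup>n-1\<^esup>\<close>, with weights \<open>|\<eta>|\<^bsup>-(n-1)\<^esup>\<close>.
  Then \<open>L\<close> becomes the sum of the weights, which diverges logarithmically. The separation of the points
  makes the Gaussians almost orthogonal.
\<close>

section \<open>Gaussian wave packets\<close>

definition gauss :: "'a::euclidean_space \<Rightarrow> real" where
  "gauss x = exp (- (norm x)\<^sup>2 / 2)"

definition packet :: "'a::euclidean_space \<Rightarrow> 'a \<Rightarrow> complex" where
  "packet \<eta> x = of_real (gauss x) * cis (\<eta> \<bullet> x)"

lemma gauss_pos [simp]: "0 < gauss x"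
  and gauss_nonneg [simp]: "0 \<le> gauss x"
  by (simp_all add: gauss_def)

lemma gauss_measurable [measurable]: "gauss \<in> borel_measurable borel"
  unfolding gauss_def by measurable

lemma cis_measurable [measurable]: "cis \<in> borel_measurable borel"
  by (intro borel_measurable_continuous_onI continuous_intros)

section \<open>Gaussian integrals in several variables\<close>

lemma exp_norm_square_prod:
  fixes x :: "'a::euclidean_space"
  shows "exp (c * (norm x)\<^sup>2) = (\<Prod>b\<in>Basis. exp (c * (x \<bullet> b)\<^sup>2))"
  by (simp add: norm_eq_sqrt_inner euclidean_inner[of x x] exp_sum sum_distrib_left
      power2_eq_square sum_nonneg)

text \<open>Fubini for product functions: \<open>lborel_eq\<close> presents \<open>lborel\<close> as
  the image of a product of one-dimensional Lebesgue measures, so Gaussian integrals reduce to one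
  variable.\<close>

lemma integral_lborel_prod:
  fixes f :: "'a::euclidean_space \<Rightarrow> real \<Rightarrow> complex"
  assumes int: "\<And>b. b \<in> Basis \<Longrightarrow> integrable lborel (f b)"
  shows "integrable lborel (\<lambda>x. \<Prod>b\<in>Basis. f b (x \<bullet> b))"
    and "(\<integral>x. (\<Prod>b\<in>Basis. f b (x \<bullet> b)) \<partial>lborel) = (\<Prod>b\<in>Basis. \<integral>y. f b y \<partial>lborel)"
proof -
  interpret product_sigma_finite "\<lambda>_::'a. lborel :: real measure" by standard
  have [measurable]: "f b \<in> borel_measurable borel" if "b \<in> Basis" for b
    using borel_measurable_integrable[OF int[OF that]] by simp
  have eq: "(\<Prod>b\<in>Basis. f b ((\<Sum>c\<in>Basis. x c *\<^sub>R c) \<bullet> b)) = (\<Prod>b\<in>Basis. f b (x b))" for x :: "'a \<Rightarrow> real"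
    by (intro prod.cong) (simp_all)
  have p: "integrable (\<Pi>\<^sub>M b\<in>Basis. lborel) (\<lambda>x. \<Prod>b\<in>Basis. f b (x b))"
    by (rule product_integrable_prod) (use int in auto)
  show "integrable lborel (\<lambda>x. \<Prod>b\<in>Basis. f b (x \<bullet> b))"
    using p by (subst lborel_eq, subst integrable_distr_eq) (simp_all add: eq del: inner_sum_left_Basis)
  show "(\<integral>x. (\<Prod>b\<in>Basis. f b (x \<bullet> b)) \<partial>lborel) = (\<Prod>b\<in>Basis. \<integral>y. f b y \<partial>lborel)"
    by (subst lborel_eq, subst integral_distr)
      (simp_all add: eq product_integral_prod[OF finite_Basis int] del: inner_sum_left_Basis)
qed

lemma integrable_exp_neg_square:
  fixes c :: real
  assumes "c > 0"
  shows "integrable lborel (\<lambda>x. exp (- c * x\<^sup>2))"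
proof -
  \<comment> \<open>The integrand is the normal density of variance 1/(2c), freed of its normalising
    constant.\<close>
  have "integrable lborel (\<lambda>x. normal_density 0 (1 / sqrt (2 * c)) x * sqrt (2 * pi * (1 / sqrt (2 * c))\<^sup>2))"
    using assms by (intro integrable_mult_left integrable_normal_density) simp
  also have "(\<lambda>x. normal_density 0 (1 / sqrt (2 * c)) x * sqrt (2 * pi * (1 / sqrt (2 * c))\<^sup>2)) = (\<lambda>x. exp (- c * x\<^sup>2))"
    using assms by (auto simp: normal_density_def fun_eq_iff power_divide)
  finally show ?thesis .
qed

lemma integrable_exp_neg_norm_square:
  fixes c :: real
  assumes "c > 0"
  shows "integrable lborel (\<lambda>x::'a::euclidean_space. exp (- c * (norm x)\<^sup>2))"
proof -
  have "integrable lborel (\<lambda>x::'a. \<Prod>b\<in>Basis. complex_of_real (exp (- c * (x \<bullet> b)\<^sup>2)))"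
    by (rule integral_lborel_prod(1)) (use integrable_exp_neg_square[OF assms] in simp)
  then have "integrable lborel (\<lambda>x::'a. complex_of_real (exp (- c * (norm x)\<^sup>2)))"
    unfolding exp_norm_square_prod by simp
  then show ?thesis by (simp add: complex_of_real_integrable_eq)
qed

text \<open>One term of the exponential series bounds the power by
  \<open>fact N * exp (1 + norm x)\<close>. The square of \<open>norm x / 2 - 1\<close> being
  nonnegative, half of the Gaussian exponent pays for this factor. The other half gives
  integrability and the Schwartz bounds.\<close>

lemma power_mult_gauss_le:
  "(1 + norm x) ^ N * gauss x \<le> fact N * exp 2 * exp (- (1/4) * (norm x)\<^sup>2)"
proof -
  let ?y = "1 + norm x"
  have "sum (\<lambda>n. inverse (fact n) * ?y ^ n) {N} \<le> (\<Sum>n. inverse (fact n) * ?y ^ n)"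
    by (rule sum_le_suminf) (auto simp: summable_exp)
  then have "?y ^ N \<le> fact N * exp ?y"
    by (simp add: exp_def field_simps)
  then have "?y ^ N * gauss x \<le> fact N * (exp ?y * gauss x)"
    by (metis gauss_nonneg mult.assoc mult_right_mono)
  also have "exp ?y * gauss x = exp (1 + norm x - (norm x)\<^sup>2 / 2)"
    by (simp add: gauss_def exp_add[symmetric])
  also have "\<dots> \<le> exp (2 + - (1/4) * (norm x)\<^sup>2)"
    using zero_le_power2[of "norm x / 2 - 1"] by (simp add: power2_eq_square algebra_simps)
  also have "\<dots> = exp 2 * exp (- (1/4) * (norm x)\<^sup>2)"
    by (simp only: exp_add)
  finally show ?thesis
    by (simp add: mult.assoc)
qed

lemma integrable_power_mult_gauss:
  "integrable lborel (\<lambda>x::'a::euclidean_space. (1 + norm x) ^ N * gauss x)"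
proof (rule Bochner_Integration.integrable_bound)
  show "integrable lborel (\<lambda>x::'a. fact N * exp 2 * exp (- (1/4) * (norm x)\<^sup>2))"
    by (intro integrable_mult_right integrable_exp_neg_norm_square) simp
qed (use power_mult_gauss_le in \<open>auto simp: abs_mult intro!: AE_I2\<close>)

text \<open>This is the characteristic function of the standard normal distribution, up to the
  factor \<open>sqrt (2 * pi)\<close>.\<close>

lemma integral_std_gauss_cis:
  fixes t :: real
  shows "integrable lborel (\<lambda>x. complex_of_real (exp (- x\<^sup>2 / 2)) * cis (t * x))"
    and "(\<integral>x. complex_of_real (exp (- x\<^sup>2 / 2)) * cis (t * x) \<partial>lborel)
      = of_real (sqrt (2 * pi) * exp (- t\<^sup>2 / 2))"
proof -
  have int: "integrable lborel (\<lambda>x::real. exp (- x\<^sup>2 / 2))"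
    using integrable_exp_neg_square[of "1/2"] by simp
  show "integrable lborel (\<lambda>x. complex_of_real (exp (- x\<^sup>2 / 2)) * cis (t * x))"
    by (rule Bochner_Integration.integrable_bound[OF int]) (auto simp: norm_mult)
  have "of_real (exp (- t\<^sup>2 / 2)) = char std_normal_distribution t"
    by (simp add: char_std_normal_distribution)
  also have "\<dots> = (\<integral>x. std_normal_density x *\<^sub>R iexp (t * x) \<partial>lborel)"
    unfolding char_def by (subst integral_density) auto
  also have "\<dots> = (\<integral>x. complex_of_real (1 / sqrt (2 * pi)) * (complex_of_real (exp (- x\<^sup>2 / 2)) * cis (t * x)) \<partial>lborel)"
    by (intro Bochner_Integration.integral_cong)
      (auto simp: std_normal_density_def scaleR_conv_of_real cis_conv_exp)
  also have "\<dots> = complex_of_real (1 / sqrt (2 * pi)) * (\<integral>x. complex_of_real (exp (- x\<^sup>2 / 2)) * cis (t * x) \<partial>lborel)"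
    by (rule integral_mult_right_zero)
  finally show "(\<integral>x. complex_of_real (exp (- x\<^sup>2 / 2)) * cis (t * x) \<partial>lborel)
      = of_real (sqrt (2 * pi) * exp (- t\<^sup>2 / 2))"
    by (simp add: field_simps)
qed

section \<open>Fourier transforms of packets\<close>

lemma cis_sum: "finite A \<Longrightarrow> cis (\<Sum>i\<in>A. f i) = (\<Prod>i\<in>A. cis (f i))"
  by (induction A rule: finite_induct) (auto simp: cis_mult[symmetric])

lemma packet_prod:
  "packet \<eta> x * cis (- (x \<bullet> \<xi>)) =
    (\<Prod>b\<in>Basis. complex_of_real (exp (- (x \<bullet> b)\<^sup>2 / 2)) * cis (((\<eta> - \<xi>) \<bullet> b) * (x \<bullet> b)))"
proof -
  have "packet \<eta> x * cis (- (x \<bullet> \<xi>)) = of_real (gauss x) * cis ((\<eta> - \<xi>) \<bullet> x)"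
    by (simp add: packet_def cis_mult inner_diff_left inner_commute[of x \<xi>])
  moreover have "gauss x = (\<Prod>b\<in>Basis. exp (- (x \<bullet> b)\<^sup>2 / 2))"
    using exp_norm_square_prod[of "-1/2" x] by (simp add: gauss_def)
  moreover have "cis ((\<eta> - \<xi>) \<bullet> x) = (\<Prod>b\<in>Basis. cis (((\<eta> - \<xi>) \<bullet> b) * (x \<bullet> b)))"
    by (subst euclidean_inner) (simp add: cis_sum)
  ultimately show ?thesis
    by (simp add: prod.distrib)
qed

text \<open>The modulation turns into a translation by \<eta>, and the integral splits over the
  coordinates. The transform is real and positive, so superpositions with nonnegative weights add up
  without cancellation in frequency.\<close>

lemma fourier_packet:
  fixes \<eta> \<xi> :: "real^'n::finite"
  shows "integrable lborel (\<lambda>x. packet \<eta> x * cis (- (x \<bullet> \<xi>)))"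
    and "fourier (packet \<eta>) \<xi> = of_real (sqrt (2 * pi) ^ CARD('n) * gauss (\<xi> - \<eta>))"
proof -
  show "integrable lborel (\<lambda>x. packet \<eta> x * cis (- (x \<bullet> \<xi>)))"
    unfolding packet_prod by (rule integral_lborel_prod(1)) (rule integral_std_gauss_cis)
  have "fourier (packet \<eta>) \<xi> = (\<Prod>b\<in>(Basis::(real^'n) set). of_real (sqrt (2 * pi) * exp (- ((\<eta> - \<xi>) \<bullet> b)\<^sup>2 / 2)))"
    unfolding fourier_def packet_prod
    by (subst integral_lborel_prod(2)) (simp_all only: integral_std_gauss_cis)
  also have "\<dots> = of_real (sqrt (2 * pi) ^ CARD('n) * gauss (\<eta> - \<xi>))"
    using exp_norm_square_prod[of "-1/2" "\<eta> - \<xi>"]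
    by (simp add: gauss_def prod.distrib)
  finally show "fourier (packet \<eta>) \<xi> = of_real (sqrt (2 * pi) ^ CARD('n) * gauss (\<xi> - \<eta>))"
    by (simp add: gauss_def norm_minus_commute)
qed

lemma fourier_sum_packet:
  fixes v :: "'i \<Rightarrow> real^'n::finite"
  assumes "finite I"
  shows "fourier (\<lambda>x. \<Sum>k\<in>I. of_real (c k) * packet (v k) x) \<xi>
    = of_real (sqrt (2 * pi) ^ CARD('n) * (\<Sum>k\<in>I. c k * gauss (\<xi> - v k)))"
proof -
  have "fourier (\<lambda>x. \<Sum>k\<in>I. of_real (c k) * packet (v k) x) \<xi>
      = (\<integral>x. (\<Sum>k\<in>I. of_real (c k) * (packet (v k) x * cis (- (x \<bullet> \<xi>)))) \<partial>lborel)"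
    by (simp add: fourier_def sum_distrib_right mult.assoc)
  also have "\<dots> = (\<Sum>k\<in>I. of_real (c k) * fourier (packet (v k)) \<xi>)"
    by (subst Bochner_Integration.integral_sum) (simp_all add: fourier_packet(1) fourier_def)
  also have "\<dots> = of_real (sqrt (2 * pi) ^ CARD('n) * (\<Sum>k\<in>I. c k * gauss (\<xi> - v k)))"
    by (simp add: fourier_packet(2) sum_distrib_left mult.left_commute)
  finally show ?thesis .
qed

section \<open>Schwartz functions with a Gaussian factor\<close>

text \<open>Linear combinations of polynomials times packets, with frequencies that may differ from
  term to term. The class is closed under partial derivatives and decays like a Gaussian, so
  membership in the Schwartz space follows by induction.\<close>

inductive gauss_poly :: "(real^'n::finite \<Rightarrow> complex) \<Rightarrow> bool" where
  packet: "gauss_poly (packet \<eta>)"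
| coord: "gauss_poly f \<Longrightarrow> gauss_poly (\<lambda>x. of_real (x $ i) * f x)"
| scale: "gauss_poly f \<Longrightarrow> gauss_poly (\<lambda>x. c * f x)"
| add: "gauss_poly f \<Longrightarrow> gauss_poly g \<Longrightarrow> gauss_poly (\<lambda>x. f x + g x)"

lemma gauss_poly_sum:
  assumes "finite I" "\<And>k. k \<in> I \<Longrightarrow> gauss_poly (f k)"
  shows "gauss_poly (\<lambda>x. \<Sum>k\<in>I. f k x)"
  using assms
proof (induction I rule: finite_induct)
  case empty
  \<comment> \<open>The zero function enters the class as 0 times a packet.\<close>
  show ?case using gauss_poly.scale[OF gauss_poly.packet, of 0] by simp
qed (auto intro: gauss_poly.add)

lemma packet_has_directional_derivative:
  fixes \<eta> x :: "real^'n::finite"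
  shows "((\<lambda>h. packet \<eta> (x + h *\<^sub>R axis i 1)) has_vector_derivative
     (\<i> * of_real (\<eta> $ i)) * packet \<eta> x + (- 1) * (of_real (x $ i) * packet \<eta> x)) (at 0)"
proof -
  let ?e = "axis i 1 :: real^'n"
  have [simp]: "a \<bullet> ?e = a $ i" "?e \<bullet> a = a $ i" for a
    by (simp_all add: inner_axis inner_axis')
  \<comment> \<open>Along a coordinate line the packet is the exponential of a complex quadratic
    polynomial in \<open>h\<close>, so a single chain rule gives the derivative.\<close>
  have eq: "packet \<eta> (x + h *\<^sub>R ?e) = exp (of_real (- (x \<bullet> x + 2 * h * (x $ i) + h\<^sup>2) / 2)
      + \<i> * of_real (\<eta> \<bullet> x + h * (\<eta> $ i)))" for h
  proof -
    have "(norm (x + h *\<^sub>R ?e))\<^sup>2 = x \<bullet> x + 2 * h * (x $ i) + h\<^sup>2"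
      unfolding power2_norm_eq_inner
      by (simp add: inner_add_left inner_add_right power2_eq_square algebra_simps)
    then show ?thesis
      unfolding packet_def gauss_def cis_conv_exp exp_add
      by (simp add: inner_add_right flip: exp_of_real)
  qed
  have p: "((\<lambda>h. - (x \<bullet> x + 2 * h * (x $ i) + h\<^sup>2) / 2) has_real_derivative - (x $ i)) (at 0)"
    and q: "((\<lambda>h. \<eta> \<bullet> x + h * (\<eta> $ i)) has_real_derivative \<eta> $ i) (at 0)"
    by (auto intro!: derivative_eq_intros)
  have inner: "((\<lambda>h. complex_of_real (- (x \<bullet> x + 2 * h * (x $ i) + h\<^sup>2) / 2) + \<i> * of_real (\<eta> \<bullet> x + h * (\<eta> $ i)))
      has_vector_derivative of_real (- (x $ i)) + \<i> * of_real (\<eta> $ i)) (at 0)"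
    using p q
    by (intro has_vector_derivative_add has_vector_derivative_mult_right has_vector_derivative_of_real)
      (simp_all add: has_real_derivative_iff_has_vector_derivative)
  have "((\<lambda>h::real. exp (of_real (- (x \<bullet> x + 2 * h * (x $ i) + h\<^sup>2) / 2)
      + \<i> * of_real (\<eta> \<bullet> x + h * (\<eta> $ i)))) has_vector_derivative
      (of_real (- (x $ i)) + \<i> * of_real (\<eta> $ i)) * packet \<eta> (x + 0 *\<^sub>R ?e)) (at 0)"
    unfolding eq
    by (rule field_vector_diff_chain_at[where g = exp, unfolded o_def, OF inner DERIV_exp])
  then show ?thesis
    unfolding eq[symmetric] by (simp add: algebra_simps)
qed

lemma gauss_poly_derivative:
  fixes f :: "real^'n::finite \<Rightarrow> complex"
  assumes "gauss_poly f"
  shows "\<exists>f'. gauss_poly f' \<and>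
    (\<forall>x. ((\<lambda>h. f (x + h *\<^sub>R axis i 1)) has_vector_derivative f' x) (at 0))"
  using assms
proof induction
  case (packet \<eta>)
  show ?case
    by (rule exI[of _ "\<lambda>x. (\<i> * of_real (\<eta> $ i)) * packet \<eta> x + (- 1) * (of_real (x $ i) * packet \<eta> x)"])
      (intro conjI allI packet_has_directional_derivative gauss_poly.intros)
next
  case (coord f j)
  then obtain f' where f': "gauss_poly f'"
    "\<And>x. ((\<lambda>h. f (x + h *\<^sub>R axis i 1)) has_vector_derivative f' x) (at 0)"
    by blast
  show ?case
  proof (intro exI conjI allI)
    show "gauss_poly (\<lambda>x. of_real (axis i 1 $ j) * f x + of_real (x $ j) * f' x)"
      using coord f' by (intro gauss_poly.intros)
    have "((\<lambda>h. complex_of_real ((x + h *\<^sub>R axis i 1) $ j)) has_vector_derivative of_real (axis i 1 $ j)) (at 0)" for x :: "real^'n"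
      by (auto intro!: derivative_eq_intros has_vector_derivative_of_real simp flip: has_real_derivative_iff_has_vector_derivative)
    from has_vector_derivative_mult[OF this f'(2)]
    show "((\<lambda>h. of_real ((x + h *\<^sub>R axis i 1) $ j) * f (x + h *\<^sub>R axis i 1))
        has_vector_derivative of_real (axis i 1 $ j) * f x + of_real (x $ j) * f' x) (at 0)" for x
      by (simp add: add.commute)
  qed
next
  case (scale f c)
  then show ?case
    by (metis gauss_poly.scale has_vector_derivative_mult_right)
next
  case (add f g)
  then obtain f' g' where "gauss_poly f'" "gauss_poly g'"
    "\<And>x. ((\<lambda>h. f (x + h *\<^sub>R axis i 1)) has_vector_derivative f' x) (at 0)"
    "\<And>x. ((\<lambda>h. g (x + h *\<^sub>R axis i 1)) has_vector_derivative g' x) (at 0)"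
    by blast
  then show ?case
    by (intro exI[of _ "\<lambda>x. f' x + g' x"] conjI allI gauss_poly.add has_vector_derivative_add)
qed

lemma gauss_poly_partials:
  assumes "gauss_poly f"
  shows "gauss_poly (partials ds f)"
proof (induction ds)
  case (Cons i ds)
  obtain f' where f': "gauss_poly f'"
    "\<And>x. ((\<lambda>h. partials ds f (x + h *\<^sub>R axis i 1)) has_vector_derivative f' x) (at 0)"
    using gauss_poly_derivative[OF Cons, of i] by blast
  \<comment> \<open>\<open>vector_derivative\<close> is defined by choice; the derivative just found
    determines its value at every point.\<close>
  then have "partials (i # ds) f = f'"
    by (auto simp: partial_dir_def vector_derivative_at)
  with f' show ?case by simp
qed (use assms in simp)

lemma gauss_poly_continuous: "gauss_poly f \<Longrightarrow> continuous_on UNIV f"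
proof (induction rule: gauss_poly.induct)
  case (packet \<eta>)
  show ?case unfolding packet_def gauss_def by (intro continuous_intros) auto
qed (intro continuous_intros; assumption)+

text \<open>A coordinate factor costs one power of \<open>1 + norm x\<close>; a sum takes the larger
  of the two powers.\<close>

lemma gauss_poly_decay:
  assumes "gauss_poly f"
  shows "\<exists>C N. 0 \<le> C \<and> (\<forall>x. norm (f x) \<le> C * ((1 + norm x) ^ N * gauss x))"
  using assms
proof induction
  case (packet \<eta>)
  show ?case
    by (rule exI[of _ 1], rule exI[of _ 0]) (simp add: packet_def norm_mult)
next
  case (coord f i)
  then obtain C N where C: "0 \<le> C" "\<And>x. norm (f x) \<le> C * ((1 + norm x) ^ N * gauss x)" by blast
  have "norm (of_real (x $ i) * f x) \<le> C * ((1 + norm x) ^ Suc N * gauss x)" for x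
  proof -
    have "\<bar>x $ i\<bar> \<le> 1 + norm x"
      using component_le_norm_cart[of x i] by simp
    then have "\<bar>x $ i\<bar> * norm (f x) \<le> (1 + norm x) * (C * ((1 + norm x) ^ N * gauss x))"
      by (intro mult_mono C) auto
    then show ?thesis by (simp add: norm_mult algebra_simps)
  qed
  with C show ?case by blast
next
  case (scale f c)
  then obtain C N where C: "0 \<le> C" "\<And>x. norm (f x) \<le> C * ((1 + norm x) ^ N * gauss x)" by blast
  have "norm (c * f x) \<le> (norm c * C) * ((1 + norm x) ^ N * gauss x)" for x
    using mult_left_mono[OF C(2), of "norm c" x] by (simp add: norm_mult mult.assoc)
  with C show ?case by (meson mult_nonneg_nonneg norm_ge_zero)
next
  case (add f g)
  then obtain C N D M where C: "0 \<le> C" "\<And>x. norm (f x) \<le> C * ((1 + norm x) ^ N * gauss x)"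
    and D: "0 \<le> D" "\<And>x. norm (g x) \<le> D * ((1 + norm x) ^ M * gauss x)" by blast
  have "norm (f x + g x) \<le> (C + D) * ((1 + norm x) ^ max N M * gauss x)" for x
  proof -
    have "C * ((1 + norm x) ^ N * gauss x) \<le> C * ((1 + norm x) ^ max N M * gauss x)"
      using C by (intro mult_left_mono mult_right_mono power_increasing) auto
    moreover have "D * ((1 + norm x) ^ M * gauss x) \<le> D * ((1 + norm x) ^ max N M * gauss x)"
      using D by (intro mult_left_mono mult_right_mono power_increasing) auto
    ultimately show ?thesis
      using norm_triangle_ineq[of "f x" "g x"] C(2)[of x] D(2)[of x] by (simp add: algebra_simps)
  qed
  with C D show ?case by (meson add_nonneg_nonneg)
qed

lemma gauss_poly_schwartz:
  assumes "gauss_poly f"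
  shows "schwartz f"
  unfolding schwartz_def
proof (intro conjI allI)
  fix ds
  have P: "gauss_poly (partials ds f)" by (rule gauss_poly_partials[OF assms])
  show "continuous_on UNIV (partials ds f)" by (rule gauss_poly_continuous[OF P])
  show "(\<lambda>h. partials ds f (x + h *\<^sub>R axis i 1)) differentiable (at 0)" for i x
    using gauss_poly_derivative[OF P] by (meson differentiableI_vector)
  fix N :: nat
  obtain C M where C: "0 \<le> C" "\<And>x. norm (partials ds f x) \<le> C * ((1 + norm x) ^ M * gauss x)"
    using gauss_poly_decay[OF P] by blast
  show "bounded ((\<lambda>x. (1 + norm x) ^ N *\<^sub>R partials ds f x) ` UNIV)"
  proof (rule boundedI, safe)
    fix x :: "real^'a"
    have "norm ((1 + norm x) ^ N *\<^sub>R partials ds f x) \<le> (1 + norm x) ^ N * (C * ((1 + norm x) ^ M * gauss x))"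
      using C(2)[of x] by (simp add: mult_left_mono)
    also have "\<dots> = C * ((1 + norm x) ^ (N + M) * gauss x)"
      by (simp add: power_add)
    also have "\<dots> \<le> C * (fact (N + M) * exp 2 * exp (- (1/4) * (norm x)\<^sup>2))"
      by (intro mult_left_mono power_mult_gauss_le C)
    also have "\<dots> \<le> C * (fact (N + M) * exp 2 * 1)"
      using C by (intro mult_left_mono) auto
    finally show "norm ((1 + norm x) ^ N *\<^sub>R partials ds f x) \<le> C * (fact (N + M) * exp 2 * 1)" .
  qed
qed

section \<open>Bounds for superpositions of packets\<close>

lemma has_bochner_integral_lborel_shift:
  fixes f :: "'a::euclidean_space \<Rightarrow> real"
  assumes "integrable lborel f"
  shows "has_bochner_integral lborel (\<lambda>x. f (x - a)) (\<integral>x. f x \<partial>lborel)"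
proof -
  have [measurable]: "f \<in> borel_measurable borel"
    using borel_measurable_integrable[OF assms] by simp
  have d: "distr lborel borel (\<lambda>x. x - a) = lborel"
    using lborel_distr_plus[of "- a"] by (simp add: add.commute[of "- a"] cong: distr_cong)
  have "integrable (distr lborel borel (\<lambda>x. x - a)) f"
    unfolding d by (rule assms)
  then have "integrable lborel (\<lambda>x. f (x - a))"
    by (subst (asm) integrable_distr_eq) auto
  moreover have "(\<integral>x. f (x - a) \<partial>lborel) = (\<integral>x. f x \<partial>distr lborel borel (\<lambda>x. x - a))"
    by (subst integral_distr) auto
  ultimately show ?thesis
    unfolding d by (simp add: has_bochner_integral_iff)
qed

lemma integral_gauss: "(\<integral>(x::real^'n). gauss x \<partial>lborel) = sqrt (2 * pi) ^ CARD('n)"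
proof -
  have "complex_of_real (\<integral>(x::real^'n). gauss x \<partial>lborel) = fourier (packet 0) (0::real^'n)"
    by (simp add: fourier_def packet_def)
  also have "\<dots> = of_real (sqrt (2 * pi) ^ CARD('n))"
    by (subst fourier_packet(2)) (simp add: gauss_def)
  finally show ?thesis by (simp only: of_real_eq_iff)
qed

text \<open>Almost orthogonality: since the total overlap of the Gaussians is at most
  \<open>A\<close>, the square of their sum is controlled by \<open>A\<close> times a sum without
  cross terms. Each remaining term is a translate of one fixed integrable function.\<close>

lemma Hdot_sq_sum_packet_le:
  fixes v :: "'i \<Rightarrow> real^'n::finite"
  assumes I: "finite I"
    and v: "\<And>k. k \<in> I \<Longrightarrow> 1 \<le> norm (v k)"
    and overlap: "\<And>\<xi>. (\<Sum>k\<in>I. gauss (\<xi> - v k)) \<le> A"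
  shows "Hdot_sq (\<lambda>x. \<Sum>k\<in>I. of_real (c k) * packet (v k) x)
    \<le> (sqrt (2 * pi) ^ CARD('n))\<^sup>2 * A * (\<integral>(x::real^'n). (1 + norm x) ^ (CARD('n) - 1) * gauss x \<partial>lborel)
      * (\<Sum>k\<in>I. (c k)\<^sup>2 * norm (v k) ^ (CARD('n) - 1))"
proof -
  define d where "d = CARD('n) - 1"
  define \<kappa> where "\<kappa> = sqrt (2 * pi) ^ CARD('n)"
  define g :: "real^'n \<Rightarrow> real" where "g x = (1 + norm x) ^ d * gauss x" for x
  have A: "0 \<le> A"
    using overlap[of 0] by (rule order_trans[rotated]) (simp add: sum_nonneg)
  have shift: "has_bochner_integral lborel (\<lambda>\<xi>. g (\<xi> - a)) (\<integral>x. g x \<partial>lborel)" for a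
    unfolding g_def using integrable_power_mult_gauss by (rule has_bochner_integral_lborel_shift)
  have dom: "has_bochner_integral lborel (\<lambda>\<xi>. \<kappa>\<^sup>2 * A * (\<Sum>k\<in>I. ((c k)\<^sup>2 * norm (v k) ^ d) * g (\<xi> - v k)))
      (\<kappa>\<^sup>2 * A * (\<Sum>k\<in>I. ((c k)\<^sup>2 * norm (v k) ^ d) * (\<integral>x. g x \<partial>lborel)))"
    by (intro has_bochner_integral_mult_right has_bochner_integral_sum shift)
  have pointwise: "norm \<xi> ^ d * (norm (fourier (\<lambda>x. \<Sum>k\<in>I. of_real (c k) * packet (v k) x) \<xi>))\<^sup>2
      \<le> \<kappa>\<^sup>2 * A * (\<Sum>k\<in>I. ((c k)\<^sup>2 * norm (v k) ^ d) * g (\<xi> - v k))" for \<xi>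
  proof -
    let ?G = "\<lambda>k. gauss (\<xi> - v k)"
    \<comment> \<open>Each Gaussian is shared equally between the two factors of Cauchy-Schwarz: one
      factor becomes the overlap, the other the diagonal sum.\<close>
    have "(\<Sum>k\<in>I. c k * ?G k)\<^sup>2 = (\<Sum>k\<in>I. sqrt (?G k) * (c k * sqrt (?G k)))\<^sup>2"
      by (simp add: mult.left_commute)
    also have "\<dots> \<le> (\<Sum>k\<in>I. (sqrt (?G k))\<^sup>2) * (\<Sum>k\<in>I. (c k * sqrt (?G k))\<^sup>2)"
      by (rule Cauchy_Schwarz_ineq_sum)
    also have "\<dots> = (\<Sum>k\<in>I. ?G k) * (\<Sum>k\<in>I. (c k)\<^sup>2 * ?G k)"
      by (simp add: power_mult_distrib)
    also have "\<dots> \<le> A * (\<Sum>k\<in>I. (c k)\<^sup>2 * ?G k)"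
      by (intro mult_right_mono overlap sum_nonneg) auto
    finally have cs: "(\<Sum>k\<in>I. c k * ?G k)\<^sup>2 \<le> A * (\<Sum>k\<in>I. (c k)\<^sup>2 * ?G k)" .
    \<comment> \<open>The Sobolev weight moves to the centre of the packet: as
      \<open>norm (v k)\<close> is at least 1, \<open>norm \<xi>\<close> is at most
      \<open>norm (v k) * (1 + norm (\<xi> - v k))\<close>, and the last factor is absorbed by the
      Gaussian.\<close>
    have le: "norm \<xi> ^ d * ?G k \<le> norm (v k) ^ d * g (\<xi> - v k)" if "k \<in> I" for k
    proof -
      have "norm \<xi> \<le> norm (v k) + 1 * norm (\<xi> - v k)"
        using norm_triangle_ineq[of "v k" "\<xi> - v k"] by simp
      also have "\<dots> \<le> norm (v k) + norm (v k) * norm (\<xi> - v k)"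
        using v[OF that] by (intro add_left_mono mult_right_mono) auto
      finally have "norm \<xi> ^ d \<le> (norm (v k) * (1 + norm (\<xi> - v k))) ^ d"
        by (intro power_mono) (auto simp: algebra_simps)
      then have "norm \<xi> ^ d * ?G k \<le> (norm (v k) * (1 + norm (\<xi> - v k))) ^ d * ?G k"
        by (rule mult_right_mono) simp
      then show ?thesis by (simp add: g_def power_mult_distrib mult.assoc)
    qed
    have "norm \<xi> ^ d * (norm (fourier (\<lambda>x. \<Sum>k\<in>I. of_real (c k) * packet (v k) x) \<xi>))\<^sup>2
        = \<kappa>\<^sup>2 * (norm \<xi> ^ d * (\<Sum>k\<in>I. c k * ?G k)\<^sup>2)"
      unfolding fourier_sum_packet[OF I] norm_of_real power2_abs \<kappa>_def[symmetric]
      by (simp add: power_mult_distrib)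
    also have "\<dots> \<le> \<kappa>\<^sup>2 * (norm \<xi> ^ d * (A * (\<Sum>k\<in>I. (c k)\<^sup>2 * ?G k)))"
      by (intro mult_left_mono cs) auto
    also have "\<dots> = \<kappa>\<^sup>2 * A * (\<Sum>k\<in>I. (c k)\<^sup>2 * (norm \<xi> ^ d * ?G k))"
      by (simp add: sum_distrib_left algebra_simps)
    also have "\<dots> \<le> \<kappa>\<^sup>2 * A * (\<Sum>k\<in>I. (c k)\<^sup>2 * (norm (v k) ^ d * g (\<xi> - v k)))"
      using A by (intro mult_left_mono sum_mono le) auto
    finally show ?thesis by (simp add: mult.assoc)
  qed
  have "Hdot_sq (\<lambda>x. \<Sum>k\<in>I. of_real (c k) * packet (v k) x)
      \<le> (\<integral>\<xi>. \<kappa>\<^sup>2 * A * (\<Sum>k\<in>I. ((c k)\<^sup>2 * norm (v k) ^ d) * g (\<xi> - v k)) \<partial>lborel)"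
    unfolding Hdot_sq_def d_def[symmetric]
  proof (rule integral_mono')
    show "0 \<le> \<kappa>\<^sup>2 * A * (\<Sum>k\<in>I. ((c k)\<^sup>2 * norm (v k) ^ d) * g (\<xi> - v k))" for \<xi>
      using A by (auto simp: g_def intro!: mult_nonneg_nonneg sum_nonneg)
  qed (rule integrable.intros[OF dom], rule pointwise)
  also have "\<dots> = \<kappa>\<^sup>2 * A * (\<Sum>k\<in>I. ((c k)\<^sup>2 * norm (v k) ^ d) * (\<integral>x. g x \<partial>lborel))"
    by (rule has_bochner_integral_integral_eq[OF dom])
  finally show ?thesis
    unfolding sum_distrib_right[symmetric] \<kappa>_def d_def g_def by (simp only: mult_ac)
qed

text \<open>In the half-angle formula one sine is bounded by its argument, the other by 1. A bound
  linear in \<open>y\<close> leads only to first moments of the Gaussian.\<close>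

lemma one_minus_abs_le_cos: "1 - \<bar>y\<bar> \<le> cos (y::real)"
proof -
  have "\<bar>sin (y / 2)\<bar> * \<bar>sin (y / 2)\<bar> \<le> \<bar>y / 2\<bar> * 1"
    by (intro mult_mono abs_sin_x_le_abs_x abs_sin_le_one) auto
  then show ?thesis
    using cos_double_sin[of "y / 2"] by (simp add: power2_eq_square)
qed

text \<open>On the line the phase vanishes at every centre \<open>v k\<close> and is Lipschitz with
  constant \<open>3 * \<bar>t\<bar>\<close>. Hence each packet loses at most a multiple of
  \<open>\<bar>t\<bar>\<close> by oscillation, at a rate independent of its frequency, and all
  packets add up coherently.\<close>

lemma norm_half_wave_sum_packet_ge:
  fixes v :: "'i \<Rightarrow> real^'n::finite"
  assumes I: "finite I" and c: "\<And>k. k \<in> I \<Longrightarrow> 0 \<le> c k"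
    and e: "norm e = 1"
    and cone: "\<And>k. k \<in> I \<Longrightarrow> norm (v k) + sqrt 2 * (e \<bullet> v k) = 0"
  shows "norm (half_wave (\<lambda>x. \<Sum>k\<in>I. of_real (c k) * packet (v k) x) t ((sqrt 2 * t) *\<^sub>R e))
    \<ge> inverse ((2 * pi) ^ CARD('n)) * sqrt (2 * pi) ^ CARD('n) * (\<Sum>k\<in>I. c k)
      * ((\<integral>(x::real^'n). gauss x \<partial>lborel) - 3 * \<bar>t\<bar> * (\<integral>(x::real^'n). (1 + norm x) * gauss x \<partial>lborel))"
proof -
  define \<kappa> where "\<kappa> = sqrt (2 * pi) ^ CARD('n)"
  have \<kappa>: "0 \<le> \<kappa>" by (simp add: \<kappa>_def)
  define u where "u = (\<lambda>x. \<Sum>k\<in>I. of_real (c k) * packet (v k) x)"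
  define p where "p \<xi> = ((sqrt 2 * t) *\<^sub>R e) \<bullet> \<xi> + t * norm \<xi>" for \<xi> :: "real^'n"
  have [measurable]: "p \<in> borel_measurable borel" unfolding p_def by measurable
  have u: "fourier u \<xi> = of_real (\<kappa> * (\<Sum>k\<in>I. c k * gauss (\<xi> - v k)))" for \<xi>
    unfolding u_def \<kappa>_def by (rule fourier_sum_packet[OF I])
  have m0: "integrable lborel (gauss :: real^'n \<Rightarrow> real)"
    using integrable_power_mult_gauss[of 0] by simp
  have m1: "integrable lborel (\<lambda>x::real^'n. (1 + norm x) * gauss x)"
    using integrable_power_mult_gauss[of 1] by simp
  have sh0: "has_bochner_integral lborel (\<lambda>\<xi>. gauss (\<xi> - a)) (\<integral>(x::real^'n). gauss x \<partial>lborel)" for a :: "real^'n"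
    using m0 by (rule has_bochner_integral_lborel_shift)
  have sh1: "has_bochner_integral lborel (\<lambda>\<xi>. (1 + norm (\<xi> - a)) * gauss (\<xi> - a)) (\<integral>(x::real^'n). (1 + norm x) * gauss x \<partial>lborel)" for a :: "real^'n"
    using m1 by (rule has_bochner_integral_lborel_shift)
  \<comment> \<open>The 3 is 2 + 1: the linear part contributes \<open>sqrt 2\<close>, rounded up to
    2, and the difference of norms contributes 1.\<close>
  have phase: "\<bar>p \<xi>\<bar> \<le> 3 * \<bar>t\<bar> * (1 + norm (\<xi> - v k))" if "k \<in> I" for k \<xi>
  proof -
    have "sqrt 2 * (e \<bullet> \<xi>) + norm \<xi> = sqrt 2 * (e \<bullet> (\<xi> - v k)) + (norm \<xi> - norm (v k))"
      using cone[OF that] by (simp add: inner_diff_right algebra_simps)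
    also have "\<bar>\<dots>\<bar> \<le> sqrt 2 * \<bar>e \<bullet> (\<xi> - v k)\<bar> + \<bar>norm \<xi> - norm (v k)\<bar>"
      by (rule order_trans[OF abs_triangle_ineq]) (simp add: abs_mult)
    also have "\<dots> \<le> 2 * norm (\<xi> - v k) + norm (\<xi> - v k)"
      using Cauchy_Schwarz_ineq2[of e "\<xi> - v k"] e sqrt2_less_2
      by (intro add_mono mult_mono norm_triangle_ineq3) auto
    finally have "\<bar>sqrt 2 * (e \<bullet> \<xi>) + norm \<xi>\<bar> \<le> 3 * (1 + norm (\<xi> - v k))" by simp
    then have "\<bar>t\<bar> * \<bar>sqrt 2 * (e \<bullet> \<xi>) + norm \<xi>\<bar> \<le> \<bar>t\<bar> * (3 * (1 + norm (\<xi> - v k)))"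
      by (rule mult_left_mono) simp
    moreover have "\<bar>p \<xi>\<bar> = \<bar>t\<bar> * \<bar>sqrt 2 * (e \<bullet> \<xi>) + norm \<xi>\<bar>"
      unfolding abs_mult[symmetric] by (simp add: p_def algebra_simps)
    ultimately show ?thesis by (simp only: mult_ac)
  qed
  have lower: "has_bochner_integral lborel
      (\<lambda>\<xi>. \<kappa> * (\<Sum>k\<in>I. c k * (gauss (\<xi> - v k) - 3 * \<bar>t\<bar> * ((1 + norm (\<xi> - v k)) * gauss (\<xi> - v k)))))
      (\<kappa> * (\<Sum>k\<in>I. c k * ((\<integral>(x::real^'n). gauss x \<partial>lborel) - 3 * \<bar>t\<bar> * (\<integral>(x::real^'n). (1 + norm x) * gauss x \<partial>lborel))))"
    by (intro has_bochner_integral_mult_right has_bochner_integral_sum has_bochner_integral_diff sh0 sh1)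
  have "integrable lborel (\<lambda>\<xi>. \<kappa> * (\<Sum>k\<in>I. c k * gauss (\<xi> - v k)))"
    by (intro integrable_mult_right Bochner_Integration.integrable_sum integrable.intros[OF sh0])
  then have int: "integrable lborel (\<lambda>\<xi>. cis (p \<xi>) * fourier u \<xi>)"
    by (rule Bochner_Integration.integrable_bound) (simp_all add: u norm_mult del: of_real_mult of_real_sum)
  \<comment> \<open>As the Fourier transform is real and nonnegative, the real part only turns the
    phase factor into a cosine, which is estimated separately against each Gaussian.\<close>
  have "\<kappa> * (\<Sum>k\<in>I. c k * (gauss (\<xi> - v k) - 3 * \<bar>t\<bar> * ((1 + norm (\<xi> - v k)) * gauss (\<xi> - v k))))
      \<le> Re (cis (p \<xi>) * fourier u \<xi>)" for \<xi>
  proof -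
    have "c k * (gauss (\<xi> - v k) - 3 * \<bar>t\<bar> * ((1 + norm (\<xi> - v k)) * gauss (\<xi> - v k)))
        \<le> c k * (cos (p \<xi>) * gauss (\<xi> - v k))" if "k \<in> I" for k
    proof (rule mult_left_mono[OF _ c[OF that]])
      have "(1 - 3 * \<bar>t\<bar> * (1 + norm (\<xi> - v k))) * gauss (\<xi> - v k) \<le> cos (p \<xi>) * gauss (\<xi> - v k)"
        using phase[OF that, of \<xi>] one_minus_abs_le_cos[of "p \<xi>"] by (intro mult_right_mono) auto
      then show "gauss (\<xi> - v k) - 3 * \<bar>t\<bar> * ((1 + norm (\<xi> - v k)) * gauss (\<xi> - v k))
          \<le> cos (p \<xi>) * gauss (\<xi> - v k)"
        by (simp add: algebra_simps)
    qed
    then have "\<kappa> * (\<Sum>k\<in>I. c k * (gauss (\<xi> - v k) - 3 * \<bar>t\<bar> * ((1 + norm (\<xi> - v k)) * gauss (\<xi> - v k))))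
        \<le> \<kappa> * (\<Sum>k\<in>I. c k * (cos (p \<xi>) * gauss (\<xi> - v k)))"
      by (intro mult_left_mono[OF _ \<kappa>] sum_mono)
    also have "\<dots> = Re (cis (p \<xi>) * fourier u \<xi>)"
      by (simp add: u sum_distrib_left algebra_simps)
    finally show ?thesis .
  qed
  then have "\<kappa> * (\<Sum>k\<in>I. c k * ((\<integral>(x::real^'n). gauss x \<partial>lborel) - 3 * \<bar>t\<bar> * (\<integral>(x::real^'n). (1 + norm x) * gauss x \<partial>lborel)))
      \<le> (\<integral>\<xi>. Re (cis (p \<xi>) * fourier u \<xi>) \<partial>lborel)"
    unfolding has_bochner_integral_integral_eq[OF lower, symmetric]
    by (intro integral_mono integrable.intros[OF lower] integrable_Re int)
  also have "\<dots> = Re (\<integral>\<xi>. cis (p \<xi>) * fourier u \<xi> \<partial>lborel)"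
    by (rule integral_Re[OF int])
  also have "\<dots> \<le> norm (\<integral>\<xi>. cis (p \<xi>) * fourier u \<xi> \<partial>lborel)"
    by (rule complex_Re_le_cmod)
  finally have "inverse ((2 * pi) ^ CARD('n)) * (\<kappa> * (\<Sum>k\<in>I. c k * ((\<integral>(x::real^'n). gauss x \<partial>lborel) - 3 * \<bar>t\<bar> * (\<integral>(x::real^'n). (1 + norm x) * gauss x \<partial>lborel))))
     \<le> inverse ((2 * pi) ^ CARD('n)) * norm (\<integral>\<xi>. cis (p \<xi>) * fourier u \<xi> \<partial>lborel)"
    by (intro mult_left_mono) auto
  also have "\<dots> = norm (half_wave u t ((sqrt 2 * t) *\<^sub>R e))"
    unfolding half_wave_def p_def[symmetric] norm_mult norm_of_real by simp
  finally show ?thesis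
    unfolding u_def \<kappa>_def by (simp only: sum_distrib_right[symmetric] mult.assoc)
qed

section \<open>Frequencies on the cone\<close>

text \<open>Splitting at the floor of \<open>s\<close>, the distances from \<open>s\<close> to the
  integers on either side are at least 0, 1, 2, and so on. Since j is at most its square, each side
  is dominated by a geometric series, uniformly in \<open>s\<close> and \<open>R\<close>.\<close>

lemma sum_gauss_nat_le:
  obtains A :: real where "\<And>s (R::nat). (\<Sum>k=1..R. exp (- (s - real k)\<^sup>2 / 2)) \<le> A"
proof
  define \<rho> :: real where "\<rho> = exp (- (1/2))"
  have \<rho>: "0 < \<rho>" "\<rho> < 1" by (simp_all add: \<rho>_def)
  have geom: "(\<Sum>j\<in>J. \<rho> ^ j) \<le> 1 / (1 - \<rho>)" if "finite J" for J
    using sum_le_suminf[of "\<lambda>j. \<rho> ^ j" J] that \<rho> by (simp add: suminf_geometric)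
  have le: "exp (- y\<^sup>2 / 2) \<le> \<rho> ^ j" if "real j \<le> \<bar>y\<bar>" for y j
  proof -
    have "real j \<le> (real j)\<^sup>2"
      by (simp add: self_le_power) (metis of_nat_le_iff of_nat_power power2_nat_le_imp_le le_square power2_eq_square)
    also have "\<dots> \<le> y\<^sup>2" using that by (metis abs_le_square_iff abs_of_nat)
    finally have "- y\<^sup>2 / 2 \<le> real j * (- (1/2))" by simp
    then have "exp (- y\<^sup>2 / 2) \<le> exp (real j * (- (1/2)))" by simp
    then show ?thesis unfolding \<rho>_def by (simp only: exp_of_nat_mult)
  qed
  fix s :: real and R :: nat
  let ?q = "\<lfloor>s\<rfloor>"
  let ?L = "{k\<in>{1..R}. int k \<le> ?q}" and ?U = "{k\<in>{1..R}. ?q < int k}"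
  have "(\<Sum>k\<in>?L. exp (- (s - real k)\<^sup>2 / 2)) \<le> (\<Sum>k\<in>?L. \<rho> ^ nat (?q - int k))"
    by (intro sum_mono le) (simp, linarith)
  also have "\<dots> = (\<Sum>j\<in>(\<lambda>k. nat (?q - int k)) ` ?L. \<rho> ^ j)"
    by (subst sum.reindex) (auto simp: inj_on_def)
  also have "\<dots> \<le> 1 / (1 - \<rho>)" by (rule geom) simp
  finally have L: "(\<Sum>k\<in>?L. exp (- (s - real k)\<^sup>2 / 2)) \<le> 1 / (1 - \<rho>)" .
  \<comment> \<open>The shift by 1 is due to \<open>s < ?q + 1\<close>: the nearest integer above
    may be arbitrarily close to \<open>s\<close>, so the exponents start at 0.\<close>
  have "(\<Sum>k\<in>?U. exp (- (s - real k)\<^sup>2 / 2)) \<le> (\<Sum>k\<in>?U. \<rho> ^ nat (int k - ?q - 1))"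
    by (intro sum_mono le) (simp, linarith)
  also have "\<dots> = (\<Sum>j\<in>(\<lambda>k. nat (int k - ?q - 1)) ` ?U. \<rho> ^ j)"
    by (subst sum.reindex) (auto simp: inj_on_def)
  also have "\<dots> \<le> 1 / (1 - \<rho>)" by (rule geom) simp
  finally have U: "(\<Sum>k\<in>?U. exp (- (s - real k)\<^sup>2 / 2)) \<le> 1 / (1 - \<rho>)" .
  have "{1..R} = ?L \<union> ?U" by auto
  then have "(\<Sum>k=1..R. exp (- (s - real k)\<^sup>2 / 2))
    = (\<Sum>k\<in>?L. exp (- (s - real k)\<^sup>2 / 2)) + (\<Sum>k\<in>?U. exp (- (s - real k)\<^sup>2 / 2))"
    by (smt (verit) sum.union_disjoint disjoint_iff finite_Un finite_atLeastAtMost mem_Collect_eq)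
  with L U show "(\<Sum>k=1..R. exp (- (s - real k)\<^sup>2 / 2)) \<le> 1 / (1 - \<rho>) + 1 / (1 - \<rho>)"
    by linarith
qed

definition cone_vec :: "'n \<Rightarrow> ('n \<Rightarrow> nat) \<Rightarrow> real^'n::finite" where
  "cone_vec i f = (\<chi> j. if j = i then - sqrt (\<Sum>j\<in>-{i}. (real (f j))\<^sup>2) else real (f j))"

text \<open>Extensional functions on the complement of \<open>i\<close> have no free value at
  \<open>i\<close>; this gives the exact cardinality and lets sums of products factorise.\<close>

definition grid :: "'n \<Rightarrow> nat \<Rightarrow> ('n::finite \<Rightarrow> nat) set" where
  "grid i R = (\<Pi>\<^sub>E j\<in>-{i}. {1..R})"

text \<open>The quantity L of the overview. The exponent equals the dimension of the lattice, which
  is the borderline case of logarithmic divergence.\<close>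

definition grid_sum :: "'n::finite \<Rightarrow> nat \<Rightarrow> real" where
  "grid_sum i R = (\<Sum>f\<in>grid i R. (1 / norm (cone_vec i f)) ^ (CARD('n) - 1))"

lemma finite_grid [simp]: "finite (grid i R)"
  by (simp add: grid_def finite_PiE)

lemma card_grid: "card (grid (i::'n::finite) R) = R ^ (CARD('n) - 1)"
  by (simp add: grid_def card_PiE Compl_eq_Diff_UNIV)

lemma norm_square_eq_split:
  fixes x :: "real^'n::finite"
  shows "(norm x)\<^sup>2 = (x $ i)\<^sup>2 + (\<Sum>j\<in>-{i}. (x $ j)\<^sup>2)"
  unfolding power2_norm_eq_inner inner_vec_def
  by (subst sum.remove[of _ i]) (simp_all add: Compl_eq_Diff_UNIV power2_eq_square)

lemma norm_cone_vec: "norm (cone_vec i f) = sqrt 2 * sqrt (\<Sum>j\<in>-{i}. (real (f j))\<^sup>2)"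
proof (rule power2_eq_imp_eq)
  show "(norm (cone_vec i f))\<^sup>2 = (sqrt 2 * sqrt (\<Sum>j\<in>-{i}. (real (f j))\<^sup>2))\<^sup>2"
    unfolding norm_square_eq_split[of _ i]
    by (simp add: cone_vec_def power_mult_distrib sum_nonneg)
qed (auto simp: sum_nonneg)

lemma cone_vec_on_cone: "norm (cone_vec i f) + sqrt 2 * (axis i 1 \<bullet> cone_vec i f) = 0"
  by (simp add: norm_cone_vec inner_axis') (simp add: cone_vec_def)

lemma norm_cone_vec_ge_1:
  fixes i :: "'n::finite"
  assumes n: "2 \<le> CARD('n)" and f: "f \<in> grid i R"
  shows "1 \<le> norm (cone_vec i f)"
proof -
  have "card (-{i}) \<ge> 1" using n by (simp add: Compl_eq_Diff_UNIV)
  then have "-{i} \<noteq> {}" by force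
  then obtain j where j: "j \<in> -{i}" by blast
  have "1 \<le> f j" using PiE_mem[OF f[unfolded grid_def] j] by simp
  then have "1 \<le> (real (f j))\<^sup>2" by (simp add: one_le_power)
  also have "\<dots> \<le> (\<Sum>j\<in>-{i}. (real (f j))\<^sup>2)" using j by (intro member_le_sum) auto
  finally have "1 * 1 \<le> sqrt 2 * sqrt (\<Sum>j\<in>-{i}. (real (f j))\<^sup>2)"
    by (intro mult_mono) auto
  then show ?thesis by (simp add: norm_cone_vec)
qed

lemma norm_cone_vec_le:
  fixes i :: "'n::finite"
  assumes f: "f \<in> grid i R"
  shows "norm (cone_vec i f) \<le> 2 * CARD('n) * R"
proof -
  have "f j \<le> R" if "j \<in> -{i}" for j
    using PiE_mem[OF f[unfolded grid_def] that] by simp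
  then have "(\<Sum>j\<in>-{i}. (real (f j))\<^sup>2) \<le> (\<Sum>j\<in>-{i}. (real R)\<^sup>2)"
    by (intro sum_mono power_mono) simp_all
  also have "\<dots> \<le> real CARD('n) * (real R)\<^sup>2"
    by (simp add: Compl_eq_Diff_UNIV mult_right_mono)
  also have "\<dots> \<le> (real CARD('n))\<^sup>2 * (real R)\<^sup>2"
    by (intro mult_right_mono self_le_power) auto
  also have "\<dots> = (CARD('n) * R)\<^sup>2" by (simp add: power_mult_distrib)
  finally have "sqrt (\<Sum>j\<in>-{i}. (real (f j))\<^sup>2) \<le> CARD('n) * R"
    by (simp add: real_le_lsqrt)
  then have "sqrt 2 * sqrt (\<Sum>j\<in>-{i}. (real (f j))\<^sup>2) \<le> 2 * real (CARD('n) * R)"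
    using sqrt2_less_2 by (intro mult_mono) (auto simp: sum_nonneg)
  then show ?thesis by (simp add: norm_cone_vec)
qed

text \<open>Dropping coordinate \<open>i\<close> only enlarges the Gaussian. What remains is a
  product over the lattice directions, so the sum over the grid becomes a product of one-dimensional
  sums, bounded uniformly in \<xi> and \<open>R\<close>.\<close>

lemma sum_gauss_cone_vec_le:
  obtains A where "\<And>(\<xi>::real^'n::finite) R. (\<Sum>f\<in>grid i R. gauss (\<xi> - cone_vec i f)) \<le> A"
proof -
  obtain A where A: "\<And>s (R::nat). (\<Sum>k=1..R. exp (- (s - real k)\<^sup>2 / 2)) \<le> A"
    using sum_gauss_nat_le by blast
  have "(\<Sum>f\<in>grid i R. gauss (\<xi> - cone_vec i f)) \<le> (\<Prod>j\<in>-{i}. A)" for \<xi> :: "real^'n" and R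
  proof -
    have "gauss (\<xi> - cone_vec i f) \<le> (\<Prod>j\<in>-{i}. exp (- (\<xi> $ j - real (f j))\<^sup>2 / 2))" for f
    proof -
      have "(\<Sum>j\<in>-{i}. (\<xi> $ j - real (f j))\<^sup>2) \<le> (norm (\<xi> - cone_vec i f))\<^sup>2"
        unfolding norm_square_eq_split[of _ i] by (simp add: cone_vec_def)
      then have "gauss (\<xi> - cone_vec i f) \<le> exp (\<Sum>j\<in>-{i}. - (\<xi> $ j - real (f j))\<^sup>2 / 2)"
        by (simp add: gauss_def sum_negf flip: sum_divide_distrib)
      then show ?thesis by (simp add: exp_sum)
    qed
    then have "(\<Sum>f\<in>grid i R. gauss (\<xi> - cone_vec i f))
        \<le> (\<Sum>f\<in>grid i R. \<Prod>j\<in>-{i}. exp (- (\<xi> $ j - real (f j))\<^sup>2 / 2))"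
      by (rule sum_mono)
    also have "\<dots> = (\<Prod>j\<in>-{i}. \<Sum>k=1..R. exp (- (\<xi> $ j - real k)\<^sup>2 / 2))"
      unfolding grid_def by (rule prod_sum_PiE[symmetric]) auto
    also have "\<dots> \<le> (\<Prod>j\<in>-{i}. A)"
      by (intro prod_mono conjI A sum_nonneg) auto
    finally show ?thesis .
  qed
  then show ?thesis by (rule that)
qed

text \<open>Doubling \<open>R\<close> adds at least \<open>R ^ (CARD('n) - 1)\<close> points of norm
  at most \<open>4 * CARD('n) * R\<close>. Number and weight compensate, so every doubling gains the
  same constant.\<close>

lemma grid_sum_double:
  fixes i :: "'n::finite"
  assumes n: "2 \<le> CARD('n)" and R: "1 \<le> R"
  shows "grid_sum i R + (1 / (4 * CARD('n))) ^ (CARD('n) - 1) \<le> grid_sum i (2 * R)"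
proof -
  define d where "d = CARD('n) - 1"
  have d: "1 \<le> d" using n by (simp add: d_def)
  have sub: "grid i R \<subseteq> grid i (2 * R)"
    unfolding grid_def by (rule PiE_mono) auto
  have "real R ^ d \<le> real ((2 * R) ^ d - R ^ d)"
  proof -
    have "2 * R ^ d \<le> 2 ^ d * R ^ d"
      using d by (intro mult_right_mono) (simp_all add: self_le_power)
    then have "R ^ d \<le> (2 * R) ^ d - R ^ d" unfolding power_mult_distrib by linarith
    then show ?thesis by (metis of_nat_le_iff of_nat_power)
  qed
  then have "(1 / (4 * real CARD('n))) ^ d \<le> real ((2 * R) ^ d - R ^ d) * (1 / (4 * CARD('n) * R)) ^ d"
    using R by (simp add: field_simps power_mult_distrib)
  also have "\<dots> = (\<Sum>f\<in>grid i (2 * R) - grid i R. (1 / (4 * CARD('n) * R)) ^ d)"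
    using sub by (simp add: card_Diff_subset card_grid d_def)
  also have "\<dots> \<le> (\<Sum>f\<in>grid i (2 * R) - grid i R. (1 / norm (cone_vec i f)) ^ d)"
  proof (intro sum_mono power_mono divide_left_mono)
    fix f assume "f \<in> grid i (2 * R) - grid i R"
    then have f: "f \<in> grid i (2 * R)" by simp
    show "norm (cone_vec i f) \<le> 4 * CARD('n) * R"
      using norm_cone_vec_le[OF f] by simp
    show "0 < (4 * CARD('n) * R) * norm (cone_vec i f)"
      using norm_cone_vec_ge_1[OF n f] R by (intro mult_pos_pos) auto
  qed auto
  also have "\<dots> = grid_sum i (2 * R) - grid_sum i R"
    unfolding grid_sum_def d_def[symmetric] using sub by (simp add: sum_diff)
  finally show ?thesis by (simp add: d_def)
qed

lemma grid_sum_unbounded: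
  fixes i :: "'n::finite"
  assumes n: "2 \<le> CARD('n)"
  shows "\<exists>R. K < grid_sum i R"
proof -
  define \<epsilon> where "\<epsilon> = (1 / (4 * real CARD('n))) ^ (CARD('n) - 1)"
  have "0 < \<epsilon>" by (simp add: \<epsilon>_def)
  have "real m * \<epsilon> \<le> grid_sum i (2 ^ m)" for m
  proof (induction m)
    case 0
    show ?case by (simp add: grid_sum_def sum_nonneg)
  next
    case (Suc m)
    then show ?case
      using grid_sum_double[OF n, of "2 ^ m" i] by (simp add: \<epsilon>_def algebra_simps)
  qed
  moreover obtain m where "K < real m * \<epsilon>"
    using reals_Archimedean3[OF \<open>0 < \<epsilon>\<close>] by blast
  ultimately show ?thesis by (meson less_le_trans)
qed

section \<open>Comparison of the two norms as the sum of the weights grows\<close>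

theorem theorem1:
  assumes "CARD('n::finite) \<ge> 4"
  shows "\<not> (\<exists>C::real. \<forall>u :: real^'n \<Rightarrow> complex. schwartz u \<longrightarrow>
            L2Linf_sq (half_wave u) \<le> ennreal (C\<^sup>2 * Hdot_sq u))"
proof
  assume "\<exists>C::real. \<forall>u :: real^'n \<Rightarrow> complex. schwartz u \<longrightarrow>
            L2Linf_sq (half_wave u) \<le> ennreal (C\<^sup>2 * Hdot_sq u)"
  then obtain C :: real where C: "\<And>u :: real^'n \<Rightarrow> complex. schwartz u \<Longrightarrow>
            L2Linf_sq (half_wave u) \<le> ennreal (C\<^sup>2 * Hdot_sq u)" by blast
  have n: "2 \<le> CARD('n)" using assms by simp
  obtain i :: 'n where True by simp
  obtain A where A: "\<And>(\<xi>::real^'n) R. (\<Sum>f\<in>grid i R. gauss (\<xi> - cone_vec i f)) \<le> A"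
    using sum_gauss_cone_vec_le by blast
  define d where "d = CARD('n) - 1"
  define m0 where "m0 = (\<integral>(x::real^'n). gauss x \<partial>lborel)"
  define m1 where "m1 = (\<integral>(x::real^'n). (1 + norm x) * gauss x \<partial>lborel)"
  have m0: "0 < m0" by (simp add: m0_def integral_gauss)
  also have "m0 \<le> m1"
    unfolding m0_def m1_def
    using integrable_power_mult_gauss[of 0] integrable_power_mult_gauss[of 1]
    by (intro integral_mono) (auto simp: algebra_simps)
  finally have m1: "0 < m1" .
  \<comment> \<open>For times up to \<tau> the phase error \<open>3 * \<bar>t\<bar> * m1\<close> is
    at most \<open>m0 / 2\<close>, so half of the main term survives.\<close>
  define \<tau> where "\<tau> = m0 / (6 * m1)"
  have \<tau>: "0 < \<tau>" using m0 m1 by (simp add: \<tau>_def)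
  define a where "a = inverse ((2 * pi) ^ CARD('n)) * sqrt (2 * pi) ^ CARD('n) * (m0 / 2)"
  have a: "0 < a" using m0 by (simp add: a_def)
  define K where "K = (sqrt (2 * pi) ^ CARD('n))\<^sup>2 * A * (\<integral>(x::real^'n). (1 + norm x) ^ d * gauss x \<partial>lborel)"
  \<comment> \<open>The space-time norm squared is at least
    \<open>2 * \<tau> * (a * L)\<^sup>2\<close>, quadratic in \<open>L\<close>, while the Sobolev
    side is at most \<open>C\<^sup>2 * (K * L)\<close>. Dividing by \<open>L\<close> bounds the sum
    of the weights independently of \<open>R\<close>.\<close>
  have "grid_sum i R \<le> C\<^sup>2 * K / (2 * \<tau> * a\<^sup>2)" if L: "0 < grid_sum i R" for R
  proof -
    define L where "L = grid_sum i R"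
    define c where "c f = (1 / norm (cone_vec i f)) ^ d" for f
    define u where "u = (\<lambda>x. \<Sum>f\<in>grid i R. of_real (c f) * packet (cone_vec i f) x)"
    have "schwartz u"
      unfolding u_def by (intro gauss_poly_schwartz gauss_poly_sum gauss_poly.intros finite_grid)
    have sumc: "(\<Sum>f\<in>grid i R. c f) = L" by (simp add: L_def grid_sum_def c_def d_def)
    have "Hdot_sq u \<le> K * (\<Sum>f\<in>grid i R. (c f)\<^sup>2 * norm (cone_vec i f) ^ d)"
      unfolding u_def K_def d_def
      by (intro Hdot_sq_sum_packet_le finite_grid norm_cone_vec_ge_1[OF n] A)
    \<comment> \<open>The weight \<open>c f\<close> is the inverse of
      \<open>norm (cone_vec i f) ^ d\<close>, so one of its two factors cancels the Sobolev
      weight.\<close>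
    also have "(\<Sum>f\<in>grid i R. (c f)\<^sup>2 * norm (cone_vec i f) ^ d) = L"
      unfolding sumc[symmetric]
    proof (rule sum.cong)
      fix f assume "f \<in> grid i R"
      from norm_cone_vec_ge_1[OF n this]
      show "(c f)\<^sup>2 * norm (cone_vec i f) ^ d = c f"
        by (simp add: c_def power2_eq_square power_divide)
    qed simp
    finally have H: "Hdot_sq u \<le> K * L" .
    have W: "a * L \<le> norm (half_wave u t ((sqrt 2 * t) *\<^sub>R axis i 1))" if t: "t \<in> {-\<tau>..\<tau>}" for t
    proof -
      have "3 * \<bar>t\<bar> * m1 \<le> 3 * \<tau> * m1" using t m1 by (intro mult_right_mono) auto
      also have "\<dots> = m0 / 2" using m1 by (simp add: \<tau>_def)
      finally have "m0 / 2 \<le> m0 - 3 * \<bar>t\<bar> * m1" by simp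
      then have "inverse ((2 * pi) ^ CARD('n)) * sqrt (2 * pi) ^ CARD('n) * L * (m0 / 2)
          \<le> inverse ((2 * pi) ^ CARD('n)) * sqrt (2 * pi) ^ CARD('n) * L * (m0 - 3 * \<bar>t\<bar> * m1)"
        using L by (intro mult_left_mono) (auto simp: L_def)
      also have "\<dots> \<le> norm (half_wave u t ((sqrt 2 * t) *\<^sub>R axis i 1))"
        unfolding u_def sumc[symmetric] m0_def m1_def
        by (intro norm_half_wave_sum_packet_ge finite_grid cone_vec_on_cone) (auto simp: c_def)
      finally show ?thesis by (simp add: a_def mult_ac)
    qed
    have "ennreal (2 * \<tau> * (a * L)\<^sup>2) = (\<integral>\<^sup>+ t. ennreal ((a * L)\<^sup>2) * indicator {-\<tau>..\<tau>} t \<partial>lborel)"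
      using \<tau> by (subst nn_integral_cmult_indicator) (simp_all add: mult.commute flip: ennreal_mult)
    also have "\<dots> \<le> L2Linf_sq (half_wave u)"
      unfolding L2Linf_sq_def
    proof (rule nn_integral_mono)
      fix t
      \<comment> \<open>The supremum over space is tested at the single point of the line belonging
        to time \<open>t\<close>.\<close>
      have "ennreal (a * L) ^ 2 \<le> (SUP x. ennreal (norm (half_wave u t x))) ^ 2" if "t \<in> {-\<tau>..\<tau>}"
        by (intro power_mono order_trans[OF ennreal_leI[OF W[OF that]]] SUP_upper) auto
      then show "ennreal ((a * L)\<^sup>2) * indicator {-\<tau>..\<tau>} t \<le> (SUP x. ennreal (norm (half_wave u t x))) ^ 2"
        using a L by (auto simp: indicator_def ennreal_power L_def)
    qed
    also have "\<dots> \<le> ennreal (C\<^sup>2 * Hdot_sq u)" by (rule C) fact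
    also have "\<dots> \<le> ennreal (C\<^sup>2 * (K * L))" by (intro ennreal_leI mult_left_mono H) auto
    finally have "ennreal (2 * \<tau> * (a * L)\<^sup>2) \<le> ennreal (C\<^sup>2 * (K * L))" .
    \<comment> \<open>\<open>ennreal\<close> sends negative numbers to 0; positivity of the left
      side is what allows the inequality to be read in the reals.\<close>
    moreover have "0 < 2 * \<tau> * (a * L)\<^sup>2"
      using \<tau> a L by (simp add: L_def)
    ultimately have "2 * \<tau> * (a * L)\<^sup>2 \<le> C\<^sup>2 * (K * L)"
      by (simp only: ennreal_le_iff2) linarith
    then have "(2 * \<tau> * a\<^sup>2 * L) * L \<le> (C\<^sup>2 * K) * L"
      by (simp add: power2_eq_square mult_ac)
    then have "2 * \<tau> * a\<^sup>2 * L \<le> C\<^sup>2 * K"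
      using L by (simp add: L_def)
    then show ?thesis
      using \<tau> a by (simp add: L_def field_simps)
  qed
  \<comment> \<open>The maximum with 0 secures the positivity of the sum under which the bound was
    derived.\<close>
  moreover obtain R where "max 0 (C\<^sup>2 * K / (2 * \<tau> * a\<^sup>2)) < grid_sum i R"
    using grid_sum_unbounded[OF n] by blast
  ultimately show False by (meson max_less_iff_conj not_le)
qed

end
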